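(* Let $w>0$ and let $\rho_T$ be the density of the occupation time $Z(T)$. Assume that $\rho_T$ is continuously differentiable in a neighborhood of $w$. Then, as $c\downarrow 0$, $$\Delta^{c,0} = \mathbb{E}\big[g_w(Z(T))\big]-\mathbb{E}\big[g_w^c(Z(T))\big] = \frac{c^2}{6}\,\rho_T'(w) + o(c^2).$$
   Context: Setting: $\boldsymbol{X}(s)\in\mathbb{R}^d$ solves the SDE $d\boldsymbol{X}(s)=a(s,\boldsymbol{X}(s))\,ds+b(s,\boldsymbol{X}(s))\,dW(s)$, $0<s<T$, $\boldsymbol{X}(0)=x_0$, with $W$ a $d$-dimensional standard Brownian motion, and $h:\mathbb{R}^d\to\mathbb{R}$ is a given function. The occupation time below the threshold $\gamma_{\text{th}}$ is $Z(s)=\int_0^s f(h(\boldsymbol{X}(r)))\,dr$ with $f(x)=\mathbf{1}_{\{x<\gamma_{\text{th}}\}}$, so $Z(T)$ is a real random variable; it is assumed to have a density $\rho_T$. Functions: $g_w(x)=\mathbf{1}_{\{x>w\}}$, and for $c>0$ the smoothed observable is $$g_w^c(x)=\begin{cases}0, & x\le w-c,\\ 0.5+\dfrac{x-w}{2c}, & w-c<x<w+c,\\ 1, & x\ge w+c.\end{cases}$$ *)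

theory Defs
  imports "HOL-Probability.Probability" "HOL-Library.Landau_Symbols"
begin

section \<open>Brownian motion\<close>

text \<open>
  \<^term>\<open>F\<close> is indexed by all reals because the library locale \<open>filtration\<close> is stated over a
  type; only its values at nonnegative times matter. The joint density below is that of
  the centred normal law with covariance matrix \<open>(t - s)\<close> times the identity.
\<close>

definition brownian_motion ::
  "'a measure \<Rightarrow> (real \<Rightarrow> 'a measure) \<Rightarrow> (real \<Rightarrow> 'a \<Rightarrow> real ^ 'n) \<Rightarrow> bool" where
  "brownian_motion M F W \<longleftrightarrow>
     prob_space M \<and>
     filtration (space M) F \<and>
     (\<forall>t. subalgebra M (F t)) \<and>
     (\<forall>t\<ge>0. W t \<in> borel_measurable (F t)) \<and>
     (AE \<omega> in M. W 0 \<omega> = 0) \<and>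
     (AE \<omega> in M. continuous_on {0..} (\<lambda>t. W t \<omega>)) \<and>
     (\<forall>s t. 0 \<le> s \<and> s < t \<longrightarrow>
        distributed M lborel (\<lambda>\<omega>. W t \<omega> - W s \<omega>)
          (\<lambda>x. ennreal (\<Prod>i\<in>UNIV. normal_density 0 (sqrt (t - s)) (x $ i))) \<and>
        prob_space.indep_set M (sets (F s))
          {(\<lambda>\<omega>. W t \<omega> - W s \<omega>) -` A \<inter> space M | A. A \<in> sets borel})"


section \<open>Stochastic integral\<close>

text \<open>
  The Ito integral on \<open>[0, T]\<close> is obtained from bounded, adapted, piecewise constant
  integrands by the usual closure: if simple processes converge to the integrand in
  \<open>L\<^sup>2([0, T])\<close> in probability, their integrals converge to the Ito integral in
  probability. Integrands are matrix valued; the norm on matrices is the Frobenius norm.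
\<close>

definition simple_integrand ::
  "(real \<Rightarrow> 'a measure) \<Rightarrow> real \<Rightarrow> nat \<Rightarrow> (nat \<Rightarrow> real) \<Rightarrow> (nat \<Rightarrow> 'a \<Rightarrow> real ^ 'n ^ 'n) \<Rightarrow> bool" where
  "simple_integrand F T n \<tau> \<xi> \<longleftrightarrow>
     \<tau> 0 = 0 \<and> \<tau> n = T \<and> (\<forall>k<n. \<tau> k \<le> \<tau> (Suc k)) \<and>
     (\<forall>k<n. \<xi> k \<in> borel_measurable (F (\<tau> k)) \<and> bounded (\<xi> k ` space (F (\<tau> k))))"

definition simple_process ::
  "nat \<Rightarrow> (nat \<Rightarrow> real) \<Rightarrow> (nat \<Rightarrow> 'a \<Rightarrow> real ^ 'n ^ 'n) \<Rightarrow> real \<Rightarrow> 'a \<Rightarrow> real ^ 'n ^ 'n" where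
  "simple_process n \<tau> \<xi> s \<omega> = (\<Sum>k<n. indicat_real {\<tau> k<..\<tau> (Suc k)} s *\<^sub>R \<xi> k \<omega>)"

definition simple_integral ::
  "(real \<Rightarrow> 'a \<Rightarrow> real ^ 'n) \<Rightarrow> nat \<Rightarrow> (nat \<Rightarrow> real) \<Rightarrow> (nat \<Rightarrow> 'a \<Rightarrow> real ^ 'n ^ 'n)
     \<Rightarrow> real \<Rightarrow> 'a \<Rightarrow> real ^ 'n" where
  "simple_integral W n \<tau> \<xi> t \<omega> =
     (\<Sum>k<n. \<xi> k \<omega> *v (W (min (\<tau> (Suc k)) t) \<omega> - W (min (\<tau> k) t) \<omega>))"

definition has_ito_integral ::
  "'a measure \<Rightarrow> (real \<Rightarrow> 'a measure) \<Rightarrow> (real \<Rightarrow> 'a \<Rightarrow> real ^ 'n) \<Rightarrow> real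
     \<Rightarrow> (real \<Rightarrow> 'a \<Rightarrow> real ^ 'n ^ 'n) \<Rightarrow> (real \<Rightarrow> 'a \<Rightarrow> real ^ 'n) \<Rightarrow> bool" where
  "has_ito_integral M F W T H I \<longleftrightarrow>
     (\<lambda>(s, \<omega>). H s \<omega>) \<in> borel_measurable (restrict_space borel {0<..<T} \<Otimes>\<^sub>M M) \<and>
     (\<forall>s\<in>{0<..<T}. H s \<in> borel_measurable (F s)) \<and>
     (AE \<omega> in M. (\<integral>\<^sup>+ s\<in>{0<..<T}. ennreal ((norm (H s \<omega>))\<^sup>2) \<partial>lborel) < \<infinity>) \<and>
     (\<forall>t\<in>{0..T}. I t \<in> borel_measurable M) \<and>
     (\<exists>n \<tau> \<xi>.
        (\<forall>m. simple_integrand F T (n m) (\<tau> m) (\<xi> m)) \<and>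
        (\<forall>\<epsilon>>0. (\<lambda>m. measure M {\<omega> \<in> space M. ennreal \<epsilon> \<le>
           (\<integral>\<^sup>+ s\<in>{0<..<T}. ennreal ((norm (simple_process (n m) (\<tau> m) (\<xi> m) s \<omega> - H s \<omega>))\<^sup>2)
              \<partial>lborel)}) \<longlonglongrightarrow> 0) \<and>
        (\<forall>t\<in>{0..T}. \<forall>\<epsilon>>0. (\<lambda>m. measure M {\<omega> \<in> space M.
           \<epsilon> \<le> dist (simple_integral W (n m) (\<tau> m) (\<xi> m) t \<omega>) (I t \<omega>)}) \<longlonglongrightarrow> 0))"


section \<open>Stochastic differential equation and occupation time\<close>

definition sde_solution ::
  "'a measure \<Rightarrow> (real \<Rightarrow> 'a measure) \<Rightarrow> (real \<Rightarrow> 'a \<Rightarrow> real ^ 'n)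
     \<Rightarrow> (real \<Rightarrow> real ^ 'n \<Rightarrow> real ^ 'n) \<Rightarrow> (real \<Rightarrow> real ^ 'n \<Rightarrow> real ^ 'n ^ 'n)
     \<Rightarrow> real ^ 'n \<Rightarrow> real \<Rightarrow> (real \<Rightarrow> 'a \<Rightarrow> real ^ 'n) \<Rightarrow> bool" where
  "sde_solution M F W a b x0 T X \<longleftrightarrow>
     (\<forall>t\<in>{0..T}. X t \<in> borel_measurable (F t)) \<and>
     (AE \<omega> in M. continuous_on {0..T} (\<lambda>t. X t \<omega>)) \<and>
     (AE \<omega> in M. X 0 \<omega> = x0) \<and>
     (AE \<omega> in M. set_integrable lborel {0..T} (\<lambda>s. a s (X s \<omega>))) \<and>
     (\<exists>I. has_ito_integral M F W T (\<lambda>s \<omega>. b s (X s \<omega>)) I \<and>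
       (\<forall>t\<in>{0..T}. AE \<omega> in M.
          X t \<omega> = x0 + (LINT s:{0..t}|lborel. a s (X s \<omega>)) + I t \<omega>))"

definition below_threshold :: "real \<Rightarrow> real \<Rightarrow> real" where
  "below_threshold \<gamma> x = (if x < \<gamma> then 1 else 0)"

definition occupation_time ::
  "(real ^ 'n \<Rightarrow> real) \<Rightarrow> real \<Rightarrow> (real \<Rightarrow> 'a \<Rightarrow> real ^ 'n) \<Rightarrow> real \<Rightarrow> 'a \<Rightarrow> real" where
  "occupation_time h \<gamma> X s \<omega> = (LINT r:{0..s}|lborel. below_threshold \<gamma> (h (X r \<omega>)))"


section \<open>Observables\<close>

definition g_obs :: "real \<Rightarrow> real \<Rightarrow> real" where
  "g_obs w x = (if x > w then 1 else 0)"

definition g_smooth :: "real \<Rightarrow> real \<Rightarrow> real \<Rightarrow> real" where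
  "g_smooth c w x =
     (if x \<le> w - c then 0
      else if x < w + c then 1 / 2 + (x - w) / (2 * c)
      else 1)"

definition C1_near :: "(real \<Rightarrow> real) \<Rightarrow> real \<Rightarrow> bool" where
  "C1_near \<rho> w \<longleftrightarrow>
     (\<exists>U. open U \<and> w \<in> U \<and> (\<forall>x\<in>U. \<rho> differentiable (at x)) \<and> continuous_on U (deriv \<rho>))"

end

theory Submission
  imports Defs
begin

text \<open>
  The expansion is a fact about any real random variable whose density \<open>\<rho>\<close> is differentiable at \<open>w\<close>;
  the occupation time is one instance. The difference of expectations is the integral of \<open>\<rho>\<close> against
  the kernel \<open>D = g_obs w - g_smooth c w\<close>, which lives on \<open>[w - c, w + c]\<close> and, off the point \<open>w\<close>, is
  odd about \<open>w\<close>. Replace \<open>\<rho>\<close> there by its first-order expansion at \<open>w\<close>. Oddness annihilates the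
  constant term, and the first moment of \<open>D\<close> about \<open>w\<close> is \<open>c\<^sup>2 / 6\<close>
  (\<open>integral_smoothing_kernel_times_affine\<close>), which yields the main term.

  The remainder is controlled by the same moment
  (\<open>integral_smoothing_kernel_times_expansion\<close>). By differentiability it is at most \<open>\<epsilon> \<bar>x - w\<bar>\<close> on the
  support of \<open>D\<close> once \<open>c\<close> is small, and \<open>D x\<close> has the sign of \<open>x - w\<close>, so that
  \<open>\<bar>D x\<bar> \<bar>x - w\<bar> = D x (x - w)\<close>. Hence the error is at most \<open>\<epsilon> c\<^sup>2 / 6\<close>.
\<close>

definition smoothing_kernel :: "real \<Rightarrow> real \<Rightarrow> real \<Rightarrow> real" where
  "smoothing_kernel c w x = g_obs w x - g_smooth c w x"

lemma g_obs_measurable [measurable]: "g_obs w \<in> borel_measurable borel"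
  unfolding g_obs_def by measurable

lemma g_smooth_measurable [measurable]: "g_smooth c w \<in> borel_measurable borel"
  unfolding g_smooth_def by measurable

lemma smoothing_kernel_measurable [measurable]: "smoothing_kernel c w \<in> borel_measurable borel"
  unfolding smoothing_kernel_def by measurable

lemma abs_g_obs_le_1: "\<bar>g_obs w x\<bar> \<le> 1"
  by (simp add: g_obs_def)

lemma abs_g_smooth_le_1:
  assumes "c > 0"
  shows "\<bar>g_smooth c w x\<bar> \<le> 1"
  using assms by (auto simp: g_smooth_def abs_le_iff field_simps)

lemma smoothing_kernel_eq_0:
  assumes "c > 0" "x \<notin> {w - c..w + c}"
  shows "smoothing_kernel c w x = 0"
  using assms by (auto simp: smoothing_kernel_def g_obs_def g_smooth_def)

lemma abs_smoothing_kernel_le_1: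
  assumes "c > 0"
  shows "\<bar>smoothing_kernel c w x\<bar> \<le> 1"
  using assms
  by (auto simp: smoothing_kernel_def g_obs_def g_smooth_def abs_le_iff field_simps)

text \<open>
  Since smoothing lowers the step to the right of \<open>w\<close> and raises it to the left, the absolute first
  moment of the kernel equals the signed one.
\<close>

lemma smoothing_kernel_sign:
  assumes "c > 0"
  shows "\<bar>smoothing_kernel c w x\<bar> * \<bar>x - w\<bar> = smoothing_kernel c w x * (x - w)"
proof (cases "x > w")
  case True
  then have "smoothing_kernel c w x \<ge> 0"
    using assms by (auto simp: smoothing_kernel_def g_obs_def g_smooth_def field_simps)
  then show ?thesis
    using True by simp
next
  case False
  then have "smoothing_kernel c w x \<le> 0"
    using assms by (auto simp: smoothing_kernel_def g_obs_def g_smooth_def field_simps)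
  then show ?thesis
    using False by (simp add: algebra_simps)
qed

lemma integrable_smoothing_kernel_times:
  assumes "c > 0" "integrable lborel \<rho>"
  shows "integrable lborel (\<lambda>x. smoothing_kernel c w x * \<rho> x)"
proof (rule Bochner_Integration.integrable_bound[OF assms(2)])
  show "(\<lambda>x. smoothing_kernel c w x * \<rho> x) \<in> borel_measurable lborel"
    using assms(2) by measurable
  show "AE x in lborel. norm (smoothing_kernel c w x * \<rho> x) \<le> norm (\<rho> x)"
    using abs_smoothing_kernel_le_1[OF assms(1), of w]
    by (auto simp: abs_mult intro!: mult_left_le_one_le)
qed

lemma integrable_smoothing_kernel_times_affine:
  assumes "c > 0"
  shows "integrable lborel (\<lambda>x. smoothing_kernel c w x * (p + q * (x - w)))"
proof -
  have "integrable lborel (\<lambda>x. indicator {w - c..w + c} x *\<^sub>R (p + q * (x - w)))"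
    by (rule borel_integrable_compact) (auto intro!: continuous_intros)
  from integrable_smoothing_kernel_times[OF assms this, of w]
  show ?thesis
    by (rule Bochner_Integration.integrable_cong[THEN iffD1, rotated -1])
       (use smoothing_kernel_eq_0[OF assms, of _ w] in \<open>auto simp: indicator_def\<close>)
qed

text \<open>
  Oddness makes the constant \<open>p\<close> drop out. The absolute values in the primitive join the
  primitives on the two sides of \<open>w\<close> continuously, so the fundamental theorem applies across the
  jump of the kernel.
\<close>

lemma integral_smoothing_kernel_times_affine:
  assumes "c > 0"
  shows "(LINT x|lborel. smoothing_kernel c w x * (p + q * (x - w))) = c\<^sup>2 / 6 * q"
proof -
  let ?f = "\<lambda>x. smoothing_kernel c w x * (p + q * (x - w))"
  define G where "G x = p * (- ((c - \<bar>x - w\<bar>)\<^sup>2 / (4 * c)))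
      + q * ((x - w) * \<bar>x - w\<bar> / 4 - (x - w) ^ 3 / (6 * c))" for x
  have "(?f has_integral (G (w + c) - G (w - c))) {w - c..w + c}"
  proof (rule fundamental_theorem_of_calculus_interior_strong[of "{w}"])
    show "continuous_on {w - c..w + c} G"
      unfolding G_def using assms by (auto intro!: continuous_intros)
  next
    fix x assume x: "x \<in> {w - c<..<w + c} - {w}"
    have "(G has_real_derivative ?f x) (at x)"
    proof (cases "x > w")
      case True
      have D: "smoothing_kernel c w x = (c - (x - w)) / (2 * c)"
        using True x assms by (auto simp: smoothing_kernel_def g_obs_def g_smooth_def field_simps)
      have "((\<lambda>x. p * (- ((c - (x - w))\<^sup>2 / (4 * c)))
          + q * ((x - w) * (x - w) / 4 - (x - w) ^ 3 / (6 * c))) has_real_derivative ?f x) (at x)"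
        unfolding D using assms
        by (auto intro!: derivative_eq_intros simp: divide_simps) (auto simp: algebra_simps power2_eq_square)
      then show ?thesis
        by (rule has_field_derivative_transform_within_open[of _ _ _ "{w<..}"])
           (use True in \<open>auto simp: G_def\<close>)
    next
      case False
      have D: "smoothing_kernel c w x = - (c + (x - w)) / (2 * c)"
        using False x assms by (auto simp: smoothing_kernel_def g_obs_def g_smooth_def field_simps)
      have "((\<lambda>x. p * (- ((c + (x - w))\<^sup>2 / (4 * c)))
          + q * (- ((x - w) * (x - w)) / 4 - (x - w) ^ 3 / (6 * c))) has_real_derivative ?f x) (at x)"
        unfolding D using assms
        by (auto intro!: derivative_eq_intros simp: divide_simps) (auto simp: algebra_simps power2_eq_square)
      then show ?thesis
        by (rule has_field_derivative_transform_within_open[of _ _ _ "{..<w}"])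
           (use False x in \<open>auto simp: G_def field_simps\<close>)
    qed
    then show "(G has_vector_derivative ?f x) (at x)"
      by (simp add: has_real_derivative_iff_has_vector_derivative)
  qed (use assms in auto)
  also have "G (w + c) - G (w - c) = c\<^sup>2 / 6 * q"
    using assms by (simp add: G_def field_simps power2_eq_square power3_eq_cube)
  finally have "(?f has_integral (c\<^sup>2 / 6 * q)) UNIV"
    by (rule has_integral_on_superset) (auto simp: smoothing_kernel_eq_0[OF assms])
  moreover have "(?f has_integral (LINT x|lborel. ?f x)) UNIV"
    by (intro has_integral_integral_lborel integrable_smoothing_kernel_times_affine assms)
  ultimately show ?thesis
    using has_integral_unique by blast
qed

text \<open>
  The kernel has size one on an interval of length \<open>2 c\<close>, so weighing it with the first-order
  remainder \<open>o(\<bar>x - w\<bar>)\<close> gains one further factor \<open>c\<close>.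
\<close>

lemma integral_smoothing_kernel_times_expansion:
  fixes \<rho> :: "real \<Rightarrow> real"
  assumes "integrable lborel \<rho>" "(\<rho> has_real_derivative d) (at w)"
  shows "(\<lambda>c. (LINT x|lborel. smoothing_kernel c w x * \<rho> x) - c\<^sup>2 / 6 * d) \<in> o[at_right 0](\<lambda>c. c\<^sup>2)"
proof (rule landau_o.smallI)
  fix \<epsilon> :: real assume "\<epsilon> > 0"
  then obtain \<delta> where \<delta>: "\<delta> > 0"
    "\<And>x. \<bar>x - w\<bar> < \<delta> \<Longrightarrow> \<bar>\<rho> x - \<rho> w - d * (x - w)\<bar> \<le> \<epsilon> * \<bar>x - w\<bar>"
    using assms(2) unfolding has_field_derivative_def has_derivative_at_alt by (auto simp: mult.commute)
  have "\<bar>(LINT x|lborel. smoothing_kernel c w x * \<rho> x) - c\<^sup>2 / 6 * d\<bar> \<le> \<epsilon> * c\<^sup>2"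
    if c: "0 < c" "c < \<delta>" for c
  proof -
    let ?D = "smoothing_kernel c w"
    let ?R = "\<lambda>x. ?D x * \<rho> x - ?D x * (\<rho> w + d * (x - w))"
    note int = integrable_smoothing_kernel_times[OF c(1) assms(1), of w]
      integrable_smoothing_kernel_times_affine[OF c(1), of w]
    have bound: "norm (?R x) \<le> ?D x * (0 + \<epsilon> * (x - w))" for x
    proof (cases "x \<in> {w - c..w + c}")
      case True
      then have "\<bar>x - w\<bar> < \<delta>"
        using c by auto
      then have "\<bar>?D x\<bar> * \<bar>\<rho> x - \<rho> w - d * (x - w)\<bar> \<le> \<bar>?D x\<bar> * (\<epsilon> * \<bar>x - w\<bar>)"
        using \<delta>(2) by (intro mult_left_mono) auto
      also have "\<dots> = ?D x * (0 + \<epsilon> * (x - w))"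
        using smoothing_kernel_sign[OF c(1), of w x] by (simp add: mult.left_commute)
      finally show ?thesis
        by (simp add: abs_mult[symmetric] algebra_simps)
    qed (simp add: smoothing_kernel_eq_0[OF c(1)])
    have "(LINT x|lborel. ?D x * \<rho> x) - c\<^sup>2 / 6 * d = (LINT x|lborel. ?R x)"
      using int by (simp add: integral_smoothing_kernel_times_affine[OF c(1)])
    also have "\<bar>\<dots>\<bar> \<le> (LINT x|lborel. ?D x * (0 + \<epsilon> * (x - w)))"
      unfolding real_norm_def[symmetric] using int bound
      by (intro Bochner_Integration.integral_norm_bound_integral
          integrable_smoothing_kernel_times_affine[OF c(1)] Bochner_Integration.integrable_diff) auto
    also have "\<dots> = c\<^sup>2 / 6 * \<epsilon>"
      by (rule integral_smoothing_kernel_times_affine[OF c(1)])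
    also have "\<dots> \<le> \<epsilon> * c\<^sup>2"
      using \<open>\<epsilon> > 0\<close> by simp
    finally show ?thesis .
  qed
  then show "\<forall>\<^sub>F c in at_right 0.
      norm ((LINT x|lborel. smoothing_kernel c w x * \<rho> x) - c\<^sup>2 / 6 * d) \<le> \<epsilon> * norm (c\<^sup>2)"
    using \<delta>(1) by (auto simp: eventually_at_right_field)
qed

lemma (in prob_space) expectation_g_obs_minus_g_smooth:
  assumes "c > 0" "distributed M lborel Z (\<lambda>x. ennreal (\<rho> x))" "\<And>x. \<rho> x \<ge> 0"
  shows "expectation (\<lambda>\<omega>. g_obs w (Z \<omega>)) - expectation (\<lambda>\<omega>. g_smooth c w (Z \<omega>))
    = (LINT x|lborel. smoothing_kernel c w x * \<rho> x)"
proof -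
  have [measurable]: "Z \<in> borel_measurable M"
    using distributed_measurable[OF assms(2)] by simp
  have "integrable M (\<lambda>\<omega>. g_obs w (Z \<omega>))"
    by (rule integrable_const_bound[of _ 1]) (auto simp: abs_g_obs_le_1)
  moreover have "integrable M (\<lambda>\<omega>. g_smooth c w (Z \<omega>))"
    by (rule integrable_const_bound[of _ 1]) (auto simp: abs_g_smooth_le_1 assms(1))
  ultimately have "expectation (\<lambda>\<omega>. g_obs w (Z \<omega>)) - expectation (\<lambda>\<omega>. g_smooth c w (Z \<omega>))
      = expectation (\<lambda>\<omega>. smoothing_kernel c w (Z \<omega>))"
    by (simp add: smoothing_kernel_def)
  also have "\<dots> = (LINT x|lborel. \<rho> x * smoothing_kernel c w x)"
    by (rule distributed_integral[OF assms(2), symmetric]) (auto simp: assms(3))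
  finally show ?thesis
    by (simp add: mult.commute)
qed

lemma (in prob_space) integrable_density:
  fixes \<rho> :: "real \<Rightarrow> real"
  assumes "distributed M lborel Z (\<lambda>x. ennreal (\<rho> x))" "\<And>x. \<rho> x \<ge> 0"
  shows "integrable lborel \<rho>"
  using distributed_integrable[OF assms(1), of "\<lambda>_. 1 :: real"] assms(2) by simp

theorem proposition3:
  fixes M :: "'a measure"
    and F :: "real \<Rightarrow> 'a measure"
    and W X :: "real \<Rightarrow> 'a \<Rightarrow> real ^ 'n"
    and a :: "real \<Rightarrow> real ^ 'n \<Rightarrow> real ^ 'n"
    and b :: "real \<Rightarrow> real ^ 'n \<Rightarrow> real ^ 'n ^ 'n"
    and x0 :: "real ^ 'n"
    and h :: "real ^ 'n \<Rightarrow> real"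
    and T \<gamma> w :: real
    and \<rho> :: "real \<Rightarrow> real"
  assumes "T > 0"
    and "brownian_motion M F W"
    and "sde_solution M F W a b x0 T X"
    and "\<And>x. \<rho> x \<ge> 0"
    and "distributed M lborel (occupation_time h \<gamma> X T) (\<lambda>x. ennreal (\<rho> x))"
    and "w > 0"
    and "C1_near \<rho> w"
  shows "(\<lambda>c. ((LINT \<omega>|M. g_obs w (occupation_time h \<gamma> X T \<omega>))
              - (LINT \<omega>|M. g_smooth c w (occupation_time h \<gamma> X T \<omega>)))
             - c\<^sup>2 / 6 * deriv \<rho> w) \<in> o[at_right 0](\<lambda>c. c\<^sup>2)"
proof -
  let ?Z = "occupation_time h \<gamma> X T"
  interpret prob_space M
    using assms(2) by (simp add: brownian_motion_def)
  have "(\<rho> has_real_derivative deriv \<rho> w) (at w)"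
    using assms(7) unfolding C1_near_def by (auto simp: DERIV_deriv_iff_real_differentiable)
  with integrable_density[OF assms(5,4)]
  have "(\<lambda>c. (LINT x|lborel. smoothing_kernel c w x * \<rho> x) - c\<^sup>2 / 6 * deriv \<rho> w)
      \<in> o[at_right 0](\<lambda>c. c\<^sup>2)"
    by (rule integral_smoothing_kernel_times_expansion)
  moreover have "\<forall>\<^sub>F c in at_right 0.
      (LINT x|lborel. smoothing_kernel c w x * \<rho> x) - c\<^sup>2 / 6 * deriv \<rho> w
      = (expectation (\<lambda>\<omega>. g_obs w (?Z \<omega>)) - expectation (\<lambda>\<omega>. g_smooth c w (?Z \<omega>)))
        - c\<^sup>2 / 6 * deriv \<rho> w"
    using eventually_at_right_less[of 0]
    by eventually_elim (simp add: expectation_g_obs_minus_g_smooth[OF _ assms(5,4)])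
  ultimately show ?thesis
    by (rule landau_o.small.in_cong[THEN iffD1, rotated])
qed

end
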